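(* Let $H$ be a real Hilbert space, let $z\in H$ and let $f,g\colon H\to(-\infty,\infty]$ be proper, lower semicontinuous and convex functions with $\mathrm{dom} f\cap\mathrm{dom} g\neq\emptyset$. Let $\beta\in(0,1)$ and let $\{r_k\}_{k\ge0}\subset(0,2(1-\beta)/\beta)$ satisfy $r_{k+1}=r_k/\sqrt{1+2r_k(1-\beta)/\beta}$ for all $k\ge0$. Let $z_0\in H$, $$x_0=\beta\,\mathrm{prox}_{\frac{2r_0(1-\beta)}{\beta+r_0(1-\beta)}f}\left(\frac{1}{\beta+r_0(1-\beta)}z_0+z\right)-\beta z,\qquad y_0=\frac1{r_0}(z_0-x_0),$$ and for $k=1,2,\dots$ $$x_k=\beta\,\mathrm{prox}_{\frac{2r_{k-1}(1-\beta)}{\beta+r_{k-1}(1-\beta)}f}\left(\frac{1}{\beta+r_{k-1}(1-\beta)}(z_{k-1}+r_{k-1}y_{k-1})+z\right)-\beta z,$$ $$y_k=\frac1{r_{k-1}}(z_{k-1}+r_{k-1}y_{k-1}-x_k),$$ $$z_k=\beta\,\mathrm{prox}_{\frac{2r_k(1-\beta)}{\beta+r_k(1-\beta)}g}\left(\frac{1}{\beta+r_k(1-\beta)}(x_k-r_ky_k)+z\right)-\beta z.$$ Let $r>0$ and $T:=(2J_{r(B_z)^{(\beta)}}-I)\circ(2J_{r(A_z)^{(\beta)}}-I)$ with $A:=\partial f$ and $B:=\partial g$. Then: (i) $J_{\partial f+\partial g}(z)$ exists if and only if there exists $x\in H$ such that $\{T^k(x)\}$ is bounded; (ii) if $J_{\partial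 f+\partial g}(z)$ exists, then $\{\frac1\beta x_k+z\}$ converges strongly (in norm) to $\mathrm{prox}_{f+g}(z)$, and $\Vert\frac1\beta x_{k+1}+z-\mathrm{prox}_{f+g}(z)\Vert=O(1/k)$ as $k\to\infty$.
   Context: $I$ is the identity on $H$; $\mathrm{dom} f=\{x: f(x)<\infty\}$; $\partial f$ is the convex subdifferential (a maximal monotone operator). For a proper lsc convex $h$ and $\rho>0$, $\mathrm{prox}_{\rho h}(x)=\mathrm{argmin}_{y\in H}\{h(y)+\frac{1}{2\rho}\Vert y-x\Vert^2\}$, so $\mathrm{prox}_{f+g}(z)$ is the unique minimizer of $\frac12\Vert x-z\Vert^2+f(x)+g(x)$. For a maximal monotone operator $M$ on $H$ and $\rho>0$, $J_{\rho M}=(I+\rho M)^{-1}$ (single-valued on all of $H$). "$J_{\partial f+\partial g}(z)$ exists" means that there is $u\in H$ with $z\in u+\partial f(u)+\partial g(u)$ (such $u$ is then unique and is denoted $J_{\partial f+\partial g}(z)$). For an operator $M\colon H\rightrightarrows H$, the operator $(M_z)^{(\beta)}\colon H\rightrightarrows H$ is defined by $$(M_z)^{(\beta)}(x)=2(1-\beta)M\left(\frac1\beta x+z\right)+\frac{1-\beta}{\beta}x;$$ it is maximal monotone when $M$ is. *)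

theory Defs
  imports "HOL-Analysis.Analysis" "HOL-Library.Landau_Symbols" "HOL-Library.Set_Algebras"
begin

definition dom_fun :: "('a \<Rightarrow> ereal) \<Rightarrow> 'a set"
  where "dom_fun f = {x. f x < \<infinity>}"

definition proper_fun :: "('a \<Rightarrow> ereal) \<Rightarrow> bool"
  where "proper_fun f \<longleftrightarrow> (\<forall>x. f x \<noteq> -\<infinity>) \<and> dom_fun f \<noteq> {}"

definition lsc_fun :: "('a::topological_space \<Rightarrow> ereal) \<Rightarrow> bool"
  where "lsc_fun f \<longleftrightarrow> (\<forall>x. f x \<le> Liminf (at x) f)"

(* The library's convex_on needs a real vector space as codomain. The right-hand side is
   well-behaved for functions that avoid the value minus infinity, i.e. for proper ones. *)
definition convex_fun :: "('a::real_vector \<Rightarrow> ereal) \<Rightarrow> bool"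
  where "convex_fun f \<longleftrightarrow>
    (\<forall>x y. \<forall>t\<in>{0<..<1}.
       f ((1 - t) *\<^sub>R x + t *\<^sub>R y) \<le> ereal (1 - t) * f x + ereal t * f y)"

(* For proper f this is empty outside the domain of f. *)
definition subdifferential :: "('a::real_inner \<Rightarrow> ereal) \<Rightarrow> 'a \<Rightarrow> 'a set"
  where "subdifferential f x = {v. \<forall>y. f x + ereal (v \<bullet> (y - x)) \<le> f y}"

definition prox :: "real \<Rightarrow> ('a::real_normed_vector \<Rightarrow> ereal) \<Rightarrow> 'a \<Rightarrow> 'a"
  where "prox \<rho> h x =
    arg_min (\<lambda>y. h y + ereal (1 / (2 * \<rho>) * (norm (y - x))\<^sup>2)) (\<lambda>_. True)"

(* Set-valued operators on H are functions of type 'a => 'a set; sums of sets below are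
   Minkowski sums. The resolvent is (I + rho M)^{-1}; as a total function it is meaningful
   where the inclusion has a unique solution. *)
definition resolvent :: "real \<Rightarrow> ('a::real_vector \<Rightarrow> 'a set) \<Rightarrow> 'a \<Rightarrow> 'a"
  where "resolvent \<rho> M x = (THE u. x \<in> {u} + (*\<^sub>R) \<rho> ` M u)"

definition reflected_resolvent :: "real \<Rightarrow> ('a::real_vector \<Rightarrow> 'a set) \<Rightarrow> 'a \<Rightarrow> 'a"
  where "reflected_resolvent \<rho> M x = 2 *\<^sub>R resolvent \<rho> M x - x"

definition resolvent_exists :: "('a::real_vector \<Rightarrow> 'a set) \<Rightarrow> 'a \<Rightarrow> bool"
  where "resolvent_exists M z \<longleftrightarrow> (\<exists>u. z \<in> {u} + M u)"

(* (M_z)^{(beta)} *)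
definition strengthening :: "('a::real_vector \<Rightarrow> 'a set) \<Rightarrow> 'a \<Rightarrow> real \<Rightarrow> 'a \<Rightarrow> 'a set"
  where "strengthening M z \<beta> x =
    (*\<^sub>R) (2 * (1 - \<beta>)) ` M ((1 / \<beta>) *\<^sub>R x + z) + {((1 - \<beta>) / \<beta>) *\<^sub>R x}"

end

theory Submission
  imports Defs
begin

text \<open>
  Put \<open>A = \<partial>f\<close>, \<open>B = \<partial>g\<close>, and let \<open>A'\<close>, \<open>B'\<close> be the operators \<open>(A_z)^(\<beta>)\<close>, \<open>(B_z)^(\<beta>)\<close>.
  Substituting \<open>u = x / \<beta> + z\<close> turns the inclusion \<open>z \<in> u + A u + B u\<close> into \<open>0 \<in> A' x + B' x\<close>, so
  the resolvent at \<open>z\<close> of a sum becomes a zero of a sum, and what is gained is that \<open>A'\<close> and \<open>B'\<close>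
  are \<open>\<gamma>\<close>-strongly monotone with \<open>\<gamma> = (1 - \<beta>) / \<beta>\<close>. The resolvents of \<open>A'\<close> and \<open>B'\<close> are
  rescaled proximal mappings, which exist everywhere because a proper, strongly convex, lower
  semicontinuous function that is bounded below has a minimizer: its minimizing sequences are
  Cauchy (\<open>strongly_midconvex_has_minimizer\<close>). The quadratic term of a proximal mapping supplies
  strong convexity, and boundedness from below because a convex lower semicontinuous function
  decreases at most linearly (\<open>convex_lsc_linear_minorant\<close>).

  Statement (i): \<open>T\<close> is a composition of reflected resolvents, hence nonexpansive, and its fixed
  points correspond to the zeros of \<open>A' + B'\<close>. A nonexpansive map with a bounded orbit has a
  fixed point, namely the asymptotic centre of the orbit, which minimizes the strongly convex
  function sending \<open>x\<close> to the limes superior of \<open>\<parallel>T^n x\<^sub>0 - x\<parallel>\<^sup>2\<close>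
  (\<open>nonexpansive_bounded_orbit_fixpoint\<close>).

  Statement (ii): the iteration is a Douglas--Rachford splitting for \<open>A' + B'\<close> with step sizes
  \<open>r_k\<close>. If \<open>y* \<in> A' x*\<close> and \<open>-y* \<in> B' x*\<close>, one step
  (\<open>douglas_rachford_step\<close>) gives
  \<open>(1 + 2 r_k \<gamma>) \<parallel>x_{k+1} - x*\<parallel>\<^sup>2 + r_k\<^sup>2 \<parallel>y_{k+1} - y*\<parallel>\<^sup>2
    \<le> \<parallel>x_k - x*\<parallel>\<^sup>2 + r_k\<^sup>2 \<parallel>y_k - y*\<parallel>\<^sup>2\<close>.
  The recursion for the step sizes says exactly that \<open>(1 + 2 r_k \<gamma>) / r_k\<^sup>2 = 1 / r_{k+1}\<^sup>2\<close>, so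
  after division by \<open>r_k\<^sup>2\<close> the quantity \<open>\<parallel>x_k - x*\<parallel>\<^sup>2 / r_k\<^sup>2 + \<parallel>y_k - y*\<parallel>\<^sup>2\<close> is
  nonincreasing from \<open>k = 1\<close> on. Hence \<open>\<parallel>x_k - x*\<parallel> = O(r_k)\<close>, while \<open>1 / r_k\<close> grows at least linearly. Finally
  \<open>x* / \<beta> + z\<close> is the minimizer that defines \<open>prox_{f+g}(z)\<close>, by the subgradient inequalities.
\<close>

section \<open>Minimizers of strongly convex functions\<close>

text \<open>
  Convexity and lower semicontinuity are stated here through real upper bounds of the values,
  that is through the epigraph; this keeps infinite values out of the estimates. The minimizer is
  the limit of a minimizing sequence, which is Cauchy because the midpoint of two nearly optimal
  points cannot fall below the infimum.
\<close>

lemma strongly_midconvex_has_minimizer: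
  fixes \<phi> :: "'a::{real_inner, complete_space} \<Rightarrow> ereal"
  assumes c: "c > 0"
    and bdd: "\<And>x. ereal m \<le> \<phi> x"
    and fin: "\<phi> x0 < \<infinity>"
    and mid: "\<And>x y a b. \<phi> x \<le> ereal a \<Longrightarrow> \<phi> y \<le> ereal b \<Longrightarrow>
      \<phi> ((1/2) *\<^sub>R (x + y)) \<le> ereal ((a + b) / 2 - c * (norm (x - y))\<^sup>2)"
    and lsc: "\<And>X u d e. X \<longlonglongrightarrow> u \<Longrightarrow> (\<And>n::nat. \<phi> (X n) \<le> ereal (d n)) \<Longrightarrow> d \<longlonglongrightarrow> e
      \<Longrightarrow> \<phi> u \<le> ereal e"
  obtains u where "\<And>y. \<phi> u \<le> \<phi> y"
proof -
  have lower: "ereal m \<le> (INF x. \<phi> x)"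
    by (intro INF_greatest bdd)
  have "(INF x. \<phi> x) < \<infinity>"
    using fin by (meson INF_lower UNIV_I le_less_trans)
  with lower obtain I where I: "(INF x. \<phi> x) = ereal I"
    by (cases "INF x. \<phi> x") auto
  have I_le: "ereal I \<le> \<phi> x" for x
    unfolding I[symmetric] by (rule INF_lower) simp
  have "\<exists>x. \<phi> x \<le> ereal (I + 1 / real (Suc n))" for n
  proof -
    have "(INF x. \<phi> x) < ereal (I + 1 / real (Suc n))" unfolding I by simp
    then show ?thesis unfolding INF_less_iff by (meson less_imp_le)
  qed
  then have "\<exists>X. \<forall>n. \<phi> (X n) \<le> ereal (I + 1 / real (Suc n))" by (intro choice allI)
  then obtain X where X: "\<And>n. \<phi> (X n) \<le> ereal (I + 1 / real (Suc n))" by blast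
  have gap: "c * (norm (X i - X j))\<^sup>2 \<le> (1 / real (Suc i) + 1 / real (Suc j)) / 2" for i j
  proof -
    have "ereal I \<le> ereal ((I + 1 / real (Suc i) + (I + 1 / real (Suc j))) / 2
        - c * (norm (X i - X j))\<^sup>2)"
      by (rule order_trans[OF I_le mid[OF X X]])
    then have "I \<le> I + (1 / real (Suc i) + 1 / real (Suc j)) / 2 - c * (norm (X i - X j))\<^sup>2"
      by (simp add: add_divide_distrib)
    then show ?thesis by linarith
  qed
  have "Cauchy X"
  proof (rule metric_CauchyI)
    fix e :: real assume e: "0 < e"
    have "0 < c * e\<^sup>2" using c e by simp
    then obtain N where N: "1 / real (Suc N) < c * e\<^sup>2" by (rule nat_approx_posE)
    have "dist (X i) (X j) < e" if "i \<ge> N" "j \<ge> N" for i j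
    proof -
      have "1 / real (Suc i) \<le> 1 / real (Suc N)" "1 / real (Suc j) \<le> 1 / real (Suc N)"
        using that by (auto intro!: divide_left_mono)
      then have "(1 / real (Suc i) + 1 / real (Suc j)) / 2
          \<le> (1 / real (Suc N) + 1 / real (Suc N)) / 2"
        by (intro divide_right_mono add_mono) auto
      also have "\<dots> = 1 / real (Suc N)" by (simp add: field_simps)
      finally have "c * (norm (X i - X j))\<^sup>2 < c * e\<^sup>2"
        using gap[of i j] N by linarith
      then have "(norm (X i - X j))\<^sup>2 < e\<^sup>2" using c by simp
      then show ?thesis using e power_less_imp_less_base[of _ 2 e] by (simp add: dist_norm)
    qed
    then show "\<exists>M. \<forall>m\<ge>M. \<forall>n\<ge>M. dist (X m) (X n) < e" by blast
  qed
  then obtain u where u: "X \<longlonglongrightarrow> u" by (meson Cauchy_convergent_iff convergent_def)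
  have "(\<lambda>n. I + 1 / real (Suc n)) \<longlonglongrightarrow> I"
    using tendsto_add[OF tendsto_const LIMSEQ_Suc[OF lim_const_over_n[of 1]], of I] by simp
  then have "\<phi> u \<le> ereal I" using lsc[OF u X] by blast
  then show ?thesis using that I_le order_trans by blast
qed

lemma norm_midpoint_sq:
  fixes x y w :: "'a::real_inner"
  shows "(norm (w - (1/2) *\<^sub>R (x + y)))\<^sup>2
    = ((norm (w - x))\<^sup>2 + (norm (w - y))\<^sup>2) / 2 - (1/4) * (norm (x - y))\<^sup>2"
  unfolding power2_norm_eq_inner
  by (simp add: inner_add_left inner_add_right inner_diff_left inner_diff_right
      inner_commute field_simps)

text \<open>
  Browder and Petryshyn: the asymptotic centre \<open>u\<close> of the bounded orbit is a fixed point, because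
  \<open>T u\<close> is asymptotically no farther from the orbit than \<open>u\<close>, and the minimizer is unique.
\<close>

lemma nonexpansive_bounded_orbit_fixpoint:
  fixes T :: "'a::{real_inner, complete_space} \<Rightarrow> 'a"
  assumes T: "\<And>x y. norm (T x - T y) \<le> norm (x - y)"
    and bdd: "bounded (range (\<lambda>k. (T ^^ k) x0))"
  obtains p where "T p = p"
proof -
  define w where "w k = (T ^^ k) x0" for k
  obtain K where K: "\<And>n. norm (w n) \<le> K"
    using bdd unfolding bounded_iff w_def by auto
  define \<phi> where "\<phi> x = limsup (\<lambda>n. ereal ((norm (w n - x))\<^sup>2))" for x
  have leI: "\<phi> x \<le> ereal a" if "\<And>e. e > 0 \<Longrightarrow> \<forall>\<^sub>F n in sequentially. (norm (w n - x))\<^sup>2 < a + e"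
    for x a
    unfolding \<phi>_def Limsup_le_iff
  proof (intro allI impI)
    fix y assume "ereal a < y"
    then obtain b where b: "ereal a < ereal b" "ereal b < y" using ereal_dense2 by blast
    show "\<forall>\<^sub>F n in sequentially. ereal ((norm (w n - x))\<^sup>2) < y"
      using that[of "b - a"] b
      by (auto elim!: eventually_mono intro: less_trans[of _ "ereal b"])
  qed
  have leD: "\<forall>\<^sub>F n in sequentially. (norm (w n - x))\<^sup>2 < a + e" if "\<phi> x \<le> ereal a" "e > 0" for x a e
  proof -
    have "ereal a < ereal (a + e)" using that by simp
    then have "\<forall>\<^sub>F n in sequentially. ereal ((norm (w n - x))\<^sup>2) < ereal (a + e)"
      using that(1) unfolding \<phi>_def Limsup_le_iff by blast
    then show ?thesis by simp
  qed
  have mid: "\<phi> ((1/2) *\<^sub>R (x + y)) \<le> ereal ((a + b) / 2 - (1/4) * (norm (x - y))\<^sup>2)"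
    if "\<phi> x \<le> ereal a" "\<phi> y \<le> ereal b" for x y a b
  proof (rule leI)
    fix e :: real assume "e > 0"
    then have "\<forall>\<^sub>F n in sequentially. (norm (w n - x))\<^sup>2 < a + e"
      "\<forall>\<^sub>F n in sequentially. (norm (w n - y))\<^sup>2 < b + e"
      using leD that by auto
    then show "\<forall>\<^sub>F n in sequentially. (norm (w n - (1/2) *\<^sub>R (x + y)))\<^sup>2
        < (a + b) / 2 - (1/4) * (norm (x - y))\<^sup>2 + e"
    proof eventually_elim
      case (elim n)
      have "((norm (w n - x))\<^sup>2 + (norm (w n - y))\<^sup>2) / 2 < (a + b) / 2 + e"
        using elim by (simp add: field_simps)
      then show ?case unfolding norm_midpoint_sq by linarith
    qed
  qed
  have fin: "\<phi> 0 < \<infinity>"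
  proof -
    have "(norm (w n))\<^sup>2 < K\<^sup>2 + e" if "e > 0" for n e
      using power_mono[OF K norm_ge_zero, of n 2] that by linarith
    then have "\<phi> 0 \<le> ereal (K\<^sup>2)" by (intro leI always_eventually) simp
    then show ?thesis using le_less_trans by fastforce
  qed
  have lsc: "\<phi> u \<le> ereal e" if X: "X \<longlonglongrightarrow> u" and d: "\<And>n::nat. \<phi> (X n) \<le> ereal (d n)"
    and de: "d \<longlonglongrightarrow> e" for X u d e
  proof (rule leI)
    fix \<epsilon> :: real assume \<epsilon>: "\<epsilon> > 0"
    define \<delta> where "\<delta> n = norm (X n - u) * (2 * (K + norm (X n)) + norm (X n - u))" for n
    have "(\<lambda>n. norm (X n - u)) \<longlonglongrightarrow> 0"
      using X by (simp add: LIM_zero tendsto_norm_zero)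
    then have "\<delta> \<longlonglongrightarrow> 0 * (2 * (K + norm u) + 0)"
      unfolding \<delta>_def by (intro tendsto_intros X)
    then have "(\<lambda>n. d n + \<delta> n) \<longlonglongrightarrow> e + 0" using de by (intro tendsto_add) auto
    then have "\<forall>\<^sub>F n in sequentially. d n + \<delta> n < e + \<epsilon> / 2"
      using \<epsilon> by (intro order_tendstoD(2)) auto
    then obtain n where n: "d n + \<delta> n < e + \<epsilon> / 2"
      by (meson eventually_happens trivial_limit_sequentially)
    have "(norm (w k - u))\<^sup>2 \<le> (norm (w k - X n))\<^sup>2 + \<delta> n" for k
    proof -
      have "norm (w k - u) \<le> norm (w k - X n) + norm (X n - u)"
        using norm_triangle_ineq[of "w k - X n" "X n - u"] by simp
      then have "(norm (w k - u))\<^sup>2 \<le> (norm (w k - X n) + norm (X n - u))\<^sup>2"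
        by (simp add: power_mono)
      also have "\<dots> = (norm (w k - X n))\<^sup>2 + norm (X n - u) * (2 * norm (w k - X n) + norm (X n - u))"
        by (simp add: power2_eq_square algebra_simps)
      also have "\<dots> \<le> (norm (w k - X n))\<^sup>2 + \<delta> n"
      proof -
        have "norm (w k - X n) \<le> K + norm (X n)"
          using K[of k] norm_triangle_ineq4[of "w k" "X n"] by linarith
        then show ?thesis unfolding \<delta>_def by (intro add_left_mono mult_left_mono) auto
      qed
      finally show ?thesis .
    qed
    moreover have "\<forall>\<^sub>F k in sequentially. (norm (w k - X n))\<^sup>2 < d n + \<epsilon> / 2"
      using leD[OF d] \<epsilon> by simp
    moreover have "p < e + \<epsilon>" if "p \<le> q + \<delta> n" "q < d n + \<epsilon> / 2" for p q
      using n that by linarith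
    ultimately show "\<forall>\<^sub>F k in sequentially. (norm (w k - u))\<^sup>2 < e + \<epsilon>"
      by (auto elim!: eventually_mono)
  qed
  have nonneg: "ereal 0 \<le> \<phi> x" for x
    unfolding \<phi>_def by (rule le_Limsup) auto
  obtain u where u: "\<And>y. \<phi> u \<le> \<phi> y"
    by (rule strongly_midconvex_has_minimizer[of "1/4" 0 \<phi> 0, OF _ nonneg fin mid lsc]) auto
  obtain a where a: "\<phi> u = ereal a"
    using nonneg[of u] u[of 0] fin by (cases "\<phi> u") auto
  have "\<phi> (T u) \<le> ereal a"
  proof (rule leI)
    fix e :: real assume "e > 0"
    then have "\<forall>\<^sub>F n in sequentially. (norm (w n - u))\<^sup>2 < a + e" using leD a by simp
    moreover have "(norm (w (Suc n) - T u))\<^sup>2 \<le> (norm (w n - u))\<^sup>2" for n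
      using T[of "w n" u] by (simp add: w_def power_mono)
    ultimately have "\<forall>\<^sub>F n in sequentially. (norm (w (Suc n) - T u))\<^sup>2 < a + e"
      by (elim eventually_mono) (rule le_less_trans)
    then show "\<forall>\<^sub>F n in sequentially. (norm (w n - T u))\<^sup>2 < a + e"
      by (subst (asm) eventually_sequentially_Suc)
  qed
  then have "\<phi> ((1/2) *\<^sub>R (u + T u)) \<le> ereal ((a + a) / 2 - (1/4) * (norm (u - T u))\<^sup>2)"
    using a by (intro mid) simp_all
  with u[of "(1/2) *\<^sub>R (u + T u)"]
  have "ereal a \<le> ereal ((a + a) / 2 - (1/4) * (norm (u - T u))\<^sup>2)"
    unfolding a by (rule order_trans)
  then have "T u = u" by simp
  then show ?thesis using that by blast
qed

section \<open>Proximal mappings and subgradients\<close>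

lemma lsc_fun_LIMSEQ_le:
  fixes h :: "'a::metric_space \<Rightarrow> ereal"
  assumes h: "lsc_fun h" and X: "X \<longlonglongrightarrow> u"
    and le: "\<And>n::nat. h (X n) \<le> ereal (d n)" and d: "d \<longlonglongrightarrow> e"
  shows "h u \<le> ereal e"
proof (rule ccontr)
  assume "\<not> h u \<le> ereal e"
  then have "ereal e < h u" by simp
  then obtain b where b: "ereal e < ereal b" "ereal b < h u"
    using ereal_dense2 by blast
  have "\<forall>\<^sub>F y in at u. ereal b < h y"
    using h b(2) less_le_trans less_LiminfD unfolding lsc_fun_def by blast
  then have "\<forall>\<^sub>F y in nhds u. ereal b < h y"
    using b(2) by (simp add: eventually_nhds_conv_at)
  then have "\<forall>\<^sub>F n in sequentially. ereal b < h (X n)"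
    using X by (rule eventually_compose_filterlim)
  moreover have "\<forall>\<^sub>F n in sequentially. d n < b"
    using d b(1) by (intro order_tendstoD(2)) auto
  ultimately have "\<forall>\<^sub>F n in sequentially. False"
  proof eventually_elim
    case (elim n)
    have "ereal b < ereal (d n)" using elim(1) le[of n] by (rule less_le_trans)
    then show ?case using elim(2) by simp
  qed
  then show False by simp
qed

lemma convex_fun_epigraph:
  assumes "convex_fun h" "h x \<le> ereal a" "h y \<le> ereal b" "0 < t" "t < 1"
  shows "h ((1 - t) *\<^sub>R x + t *\<^sub>R y) \<le> ereal ((1 - t) * a + t * b)"
proof -
  have "h ((1 - t) *\<^sub>R x + t *\<^sub>R y) \<le> ereal (1 - t) * h x + ereal t * h y"
    using assms unfolding convex_fun_def by simp
  also have "\<dots> \<le> ereal (1 - t) * ereal a + ereal t * ereal b"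
    using assms by (intro add_mono ereal_mult_left_mono) auto
  finally show ?thesis by simp
qed

lemma proper_fun_point:
  assumes "proper_fun h"
  obtains x a where "h x = ereal a"
proof -
  obtain x where "h x < \<infinity>" "h x \<noteq> -\<infinity>"
    using assms unfolding proper_fun_def dom_fun_def by auto
  then show ?thesis using that by (cases "h x") auto
qed

text \<open>
  Lower semicontinuity bounds \<open>h\<close> from below on a small ball around a point \<open>p\<close> of its domain.
  Convexity on the segment from \<open>p\<close> to a far point \<open>y\<close> carries the bound to \<open>y\<close>: the value at the
  point of the segment at distance \<open>\<delta>\<close> from \<open>p\<close> is controlled, so \<open>h\<close> decreases at most linearly.
\<close>

lemma convex_lsc_linear_minorant:
  fixes h :: "'a::real_inner \<Rightarrow> ereal"
  assumes h: "proper_fun h" "lsc_fun h" "convex_fun h"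
  obtains b a p where "b \<ge> 0" "\<And>y. ereal (a - b * norm (y - p)) \<le> h y"
proof -
  obtain p c where p: "h p = ereal c" using proper_fun_point[OF h(1)] .
  have "\<forall>\<^sub>F y in at p. ereal (c - 1) < h y"
  proof (rule less_LiminfD)
    have "ereal (c - 1) < h p" by (simp add: p)
    also have "h p \<le> Liminf (at p) h" using h(2) by (simp add: lsc_fun_def)
    finally show "ereal (c - 1) < Liminf (at p) h" .
  qed
  then obtain d where d: "d > 0" "\<And>y. y \<noteq> p \<Longrightarrow> dist y p < d \<Longrightarrow> ereal (c - 1) < h y"
    unfolding eventually_at by auto
  define \<delta> where "\<delta> = d / 2"
  have \<delta>: "0 < \<delta>" "\<delta> < d" using d(1) by (auto simp: \<delta>_def)
  have near: "ereal (c - 1) \<le> h y" if "norm (y - p) < d" for y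
    using d(2)[of y] that p by (cases "y = p") (auto simp: dist_norm)
  have "ereal (c - 1 - (1 / \<delta>) * norm (y - p)) \<le> h y" for y
  proof (cases "norm (y - p) < d")
    case True
    have "ereal (c - 1 - (1 / \<delta>) * norm (y - p)) \<le> ereal (c - 1)" using \<delta> by simp
    then show ?thesis using near[OF True] order_trans by blast
  next
    case far: False
    show ?thesis
    proof (cases "h y")
      case (real s)
      define t where "t = \<delta> / norm (y - p)"
      have pos: "norm (y - p) > 0" using far d(1) by linarith
      have t: "0 < t" "t < 1" using far \<delta> pos by (auto simp: t_def)
      let ?q = "(1 - t) *\<^sub>R p + t *\<^sub>R y"
      have "?q - p = t *\<^sub>R (y - p)" by (simp add: algebra_simps)
      then have "norm (?q - p) = \<delta>" using pos \<delta> by (simp add: t_def)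
      then have "ereal (c - 1) \<le> h ?q" using near \<delta> by simp
      also have "\<dots> \<le> ereal ((1 - t) * c + t * s)"
        using convex_fun_epigraph[OF h(3)] p real t by simp
      finally have "c - 1 \<le> (1 - t) * c + t * s" by simp
      then have "t * (c - s) \<le> 1" by (simp add: algebra_simps)
      then have "c - s \<le> 1 / t" using t by (simp add: field_simps)
      also have "1 / t = (1 / \<delta>) * norm (y - p)" by (simp add: t_def)
      finally show ?thesis using real by simp
    qed (use h(1) in \<open>auto simp: proper_fun_def\<close>)
  qed
  then show ?thesis using that[of "1 / \<delta>" "c - 1" p] \<delta> by simp
qed

lemma prox_minimizes:
  fixes h :: "'a::{real_inner, complete_space} \<Rightarrow> ereal"
  assumes h: "proper_fun h" "lsc_fun h" "convex_fun h" and \<rho>: "\<rho> > 0"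
  shows "h (prox \<rho> h x) + ereal (1 / (2 * \<rho>) * (norm (prox \<rho> h x - x))\<^sup>2)
    \<le> h y + ereal (1 / (2 * \<rho>) * (norm (y - x))\<^sup>2)"
proof -
  define q where "q v = 1 / (2 * \<rho>) * (norm (v - x))\<^sup>2" for v
  define \<phi> where "\<phi> v = h v + ereal (q v)" for v
  have \<phi>_le: "\<phi> v \<le> ereal a \<longleftrightarrow> h v \<le> ereal (a - q v)" for v a
    unfolding \<phi>_def by (cases "h v") auto
  obtain b a p where b: "b \<ge> 0" and minorant: "\<And>v. ereal (a - b * norm (v - p)) \<le> h v"
    using convex_lsc_linear_minorant[OF h] by blast
  have bdd: "ereal (a - b * norm (x - p) - \<rho> * b\<^sup>2 / 2) \<le> \<phi> v" for v
  proof -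
    have "b * norm (v - p) \<le> b * (norm (v - x) + norm (x - p))"
      using norm_triangle_ineq[of "v - x" "x - p"] b by (intro mult_left_mono) auto
    moreover have "b * norm (v - x) - \<rho> * b\<^sup>2 / 2 \<le> q v"
    proof -
      have "0 \<le> (norm (v - x) - \<rho> * b)\<^sup>2 / (2 * \<rho>)" using \<rho> by simp
      also have "\<dots> = q v - b * norm (v - x) + \<rho> * b\<^sup>2 / 2"
        using \<rho> by (simp add: q_def power2_eq_square field_simps)
      finally show ?thesis by simp
    qed
    ultimately have "a - b * norm (x - p) - \<rho> * b\<^sup>2 / 2 \<le> (a - b * norm (v - p)) + q v"
      by (simp add: algebra_simps)
    then have "ereal (a - b * norm (x - p) - \<rho> * b\<^sup>2 / 2) \<le> ereal (a - b * norm (v - p)) + ereal (q v)"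
      by simp
    also have "\<dots> \<le> \<phi> v" unfolding \<phi>_def by (intro add_mono minorant) auto
    finally show ?thesis .
  qed
  obtain p' c' where "h p' = ereal c'" using proper_fun_point[OF h(1)] .
  then have fin: "\<phi> p' < \<infinity>" by (simp add: \<phi>_def)
  have mid: "\<phi> ((1/2) *\<^sub>R (v + w)) \<le> ereal ((s + t) / 2 - (1 / (8 * \<rho>)) * (norm (v - w))\<^sup>2)"
    if vw: "\<phi> v \<le> ereal s" "\<phi> w \<le> ereal t" for v w s t
  proof -
    have "h ((1 - 1/2) *\<^sub>R v + (1/2) *\<^sub>R w)
        \<le> ereal ((1 - 1/2) * (s - q v) + (1/2) * (t - q w))"
      using vw[unfolded \<phi>_le] by (intro convex_fun_epigraph[OF h(3)]) auto
    moreover have "q ((1/2) *\<^sub>R (v + w)) = (q v + q w) / 2 - (1 / (8 * \<rho>)) * (norm (v - w))\<^sup>2"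
      unfolding q_def norm_minus_commute[of _ x] norm_midpoint_sq using \<rho>
      by (simp add: norm_minus_commute[of x] field_simps)
    moreover have "(1 - 1/2) * (s - q v) + (1/2) * (t - q w)
        = (s + t) / 2 - (1 / (8 * \<rho>)) * (norm (v - w))\<^sup>2
          - ((q v + q w) / 2 - (1 / (8 * \<rho>)) * (norm (v - w))\<^sup>2)"
      by (simp add: field_simps)
    ultimately show ?thesis
      unfolding \<phi>_le by (simp add: scaleR_right_distrib)
  qed
  have lsc: "\<phi> u \<le> ereal e" if X: "X \<longlonglongrightarrow> u" and d: "\<And>n::nat. \<phi> (X n) \<le> ereal (d n)"
    and de: "d \<longlonglongrightarrow> e" for X u d e
  proof -
    have "(\<lambda>n. d n - q (X n)) \<longlonglongrightarrow> e - q u"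
      unfolding q_def by (intro tendsto_intros X de)
    then show ?thesis using lsc_fun_LIMSEQ_le[OF h(2) X d[unfolded \<phi>_le]] unfolding \<phi>_le by blast
  qed
  obtain u where u: "\<And>v. \<phi> u \<le> \<phi> v"
    by (rule strongly_midconvex_has_minimizer[of "1 / (8 * \<rho>)", OF _ bdd fin mid lsc])
      (use \<rho> in auto)
  then have "is_arg_min \<phi> (\<lambda>_. True) u" by (simp add: is_arg_min_linorder)
  then have "is_arg_min \<phi> (\<lambda>_. True) (prox \<rho> h x)"
    unfolding prox_def arg_min_def \<phi>_def q_def by (rule someI)
  then show ?thesis by (simp add: is_arg_min_linorder \<phi>_def q_def)
qed

text \<open>
  Compare the proximal point \<open>u\<close> with the points \<open>u + t (y - u)\<close>: after division by \<open>t\<close> the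
  quadratic terms leave the linear form of the subgradient plus an error of order \<open>t\<close>.
\<close>

lemma prox_residual_in_subdifferential:
  fixes h :: "'a::{real_inner, complete_space} \<Rightarrow> ereal"
  assumes h: "proper_fun h" "lsc_fun h" "convex_fun h" and \<rho>: "\<rho> > 0"
  shows "(1 / \<rho>) *\<^sub>R (x - prox \<rho> h x) \<in> subdifferential h (prox \<rho> h x)"
proof -
  define u where "u = prox \<rho> h x"
  note min = prox_minimizes[OF h \<rho>, where x = x, folded u_def]
  obtain p c where p: "h p = ereal c" using proper_fun_point[OF h(1)] .
  have "h u \<noteq> \<infinity>" using min[of p] p by auto
  then obtain s where s: "h u = ereal s"
    using h(1) by (cases "h u") (auto simp: proper_fun_def)
  have "h u + ereal (((1 / \<rho>) *\<^sub>R (x - u)) \<bullet> (y - u)) \<le> h y" for y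
  proof (cases "h y")
    case (real b)
    define l where "l = ((x - u) \<bullet> (y - u)) / \<rho>"
    define Q where "Q = (norm (y - u))\<^sup>2 / (2 * \<rho>)"
    have "s + l - b \<le> t * Q" if t: "0 < t" "t < 1" for t
    proof -
      let ?v = "(1 - t) *\<^sub>R u + t *\<^sub>R y"
      have "h ?v \<le> ereal ((1 - t) * s + t * b)"
        using convex_fun_epigraph[OF h(3)] s real t by simp
      then have "h ?v + ereal (1 / (2 * \<rho>) * (norm (?v - x))\<^sup>2)
          \<le> ereal ((1 - t) * s + t * b) + ereal (1 / (2 * \<rho>) * (norm (?v - x))\<^sup>2)"
        by (rule add_right_mono)
      from order_trans[OF min[of ?v] this]
      have "ereal s + ereal (1 / (2 * \<rho>) * (norm (u - x))\<^sup>2)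
          \<le> ereal ((1 - t) * s + t * b) + ereal (1 / (2 * \<rho>) * (norm (?v - x))\<^sup>2)"
        unfolding s .
      then have "s + 1 / (2 * \<rho>) * (norm (u - x))\<^sup>2
          \<le> (1 - t) * s + t * b + 1 / (2 * \<rho>) * (norm (?v - x))\<^sup>2" by simp
      moreover have "1 / (2 * \<rho>) * (norm (?v - x))\<^sup>2
          = 1 / (2 * \<rho>) * (norm (u - x))\<^sup>2 - t * l + t\<^sup>2 * Q"
      proof -
        have v: "?v - x = - (x - u) + t *\<^sub>R (y - u)" by (simp add: algebra_simps)
        have "(norm (- a + t *\<^sub>R c))\<^sup>2 = (norm a)\<^sup>2 - 2 * t * (a \<bullet> c) + t\<^sup>2 * (norm c)\<^sup>2" for a c :: 'a
          unfolding power2_norm_eq_inner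
          by (simp add: inner_diff_left inner_diff_right inner_commute power2_eq_square)
        then have "(norm (?v - x))\<^sup>2
            = (norm (u - x))\<^sup>2 - 2 * t * ((x - u) \<bullet> (y - u)) + t\<^sup>2 * (norm (y - u))\<^sup>2"
          unfolding v norm_minus_commute[of u x] by blast
        then show ?thesis
          using \<rho> by (simp add: l_def Q_def diff_divide_distrib add_divide_distrib)
      qed
      ultimately have "t * (s + l - b) \<le> t * (t * Q)"
        by (simp add: algebra_simps power2_eq_square)
      then show ?thesis using t by simp
    qed
    then have "\<forall>\<^sub>F t in at_right 0. s + l - b \<le> t * Q"
      by (auto simp: eventually_at_right[of 0 1] intro!: exI[of _ 1])
    moreover have "((\<lambda>t. t * Q) \<longlongrightarrow> 0 * Q) (at_right 0)" by (intro tendsto_intros)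
    ultimately have "s + l - b \<le> 0"
      by (intro tendsto_lowerbound[of "\<lambda>t. t * Q" 0 "at_right 0"]) auto
    then show ?thesis using s real by (simp add: l_def)
  qed (use h(1) in \<open>auto simp: proper_fun_def\<close>)
  then show ?thesis unfolding subdifferential_def u_def by simp
qed

lemma subdifferential_finite:
  assumes "proper_fun h" "v \<in> subdifferential h x"
  obtains a where "h x = ereal a"
proof -
  obtain p c where "h p = ereal c" using proper_fun_point[OF assms(1)] .
  moreover have "h x + ereal (v \<bullet> (p - x)) \<le> h p"
    using assms(2) by (simp add: subdifferential_def)
  ultimately have "h x \<noteq> \<infinity>" "h x \<noteq> -\<infinity>" using assms(1) by (auto simp: proper_fun_def)
  then show ?thesis using that by (cases "h x") auto
qed

lemma resolvent_sum_eq_prox: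
  fixes f g :: "'a::real_inner \<Rightarrow> ereal"
  assumes f: "proper_fun f" and g: "proper_fun g"
    and a: "a \<in> subdifferential f u" and b: "b \<in> subdifferential g u" and z: "z = u + (a + b)"
  shows "prox 1 (\<lambda>x. f x + g x) z = u"
proof -
  define \<phi> where "\<phi> y = f y + g y + ereal (1 / (2 * 1) * (norm (y - z))\<^sup>2)" for y
  obtain s where s: "f u = ereal s" using subdifferential_finite[OF f a] .
  obtain t where t: "g u = ereal t" using subdifferential_finite[OF g b] .
  \<comment> \<open>The inequality is quantitative because the minimizer also has to be unique.\<close>
  have growth: "\<phi> u + ereal ((norm (y - u))\<^sup>2 / 2) \<le> \<phi> y" for y
  proof -
    have "ereal (s + a \<bullet> (y - u)) \<le> f y" "ereal (t + b \<bullet> (y - u)) \<le> g y"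
      using a b s t unfolding subdifferential_def by auto
    then have "ereal (s + a \<bullet> (y - u)) + ereal (t + b \<bullet> (y - u)) + ereal (1 / (2 * 1) * (norm (y - z))\<^sup>2)
        \<le> \<phi> y"
      unfolding \<phi>_def by (intro add_mono) auto
    moreover have "(norm (y - z))\<^sup>2
        = (norm (u - z))\<^sup>2 + (norm (y - u))\<^sup>2 - 2 * (a \<bullet> (y - u)) - 2 * (b \<bullet> (y - u))"
      unfolding z power2_norm_eq_inner
      by (simp add: inner_add_left inner_add_right inner_diff_left inner_diff_right inner_commute)
    moreover have "\<phi> u = ereal (s + t + (norm (u - z))\<^sup>2 / 2)" by (simp add: \<phi>_def s t)
    ultimately show ?thesis by (simp add: add_divide_distrib diff_divide_distrib algebra_simps)
  qed
  have \<phi>u: "\<phi> u = ereal (s + t + (norm (u - z))\<^sup>2 / 2)" by (simp add: \<phi>_def s t)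
  have least: "\<phi> u \<le> \<phi> y" for y
    using growth[of y] by (rule order_trans[rotated]) (simp add: \<phi>u)
  then have "is_arg_min \<phi> (\<lambda>_. True) u" by (simp add: is_arg_min_linorder)
  then have "is_arg_min \<phi> (\<lambda>_. True) (prox 1 (\<lambda>x. f x + g x) z)"
    unfolding prox_def arg_min_def \<phi>_def by (rule someI)
  then have "\<phi> (prox 1 (\<lambda>x. f x + g x) z) \<le> \<phi> u" by (simp add: is_arg_min_linorder)
  then have "\<phi> u + ereal ((norm (prox 1 (\<lambda>x. f x + g x) z - u))\<^sup>2 / 2) \<le> \<phi> u"
    using growth order_trans by blast
  then show ?thesis by (simp add: \<phi>u)
qed

section \<open>Strongly monotone operators and their resolvents\<close>

text \<open>The modulus \<open>0\<close> gives plain monotonicity.\<close>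

definition strongly_monotone :: "real \<Rightarrow> ('a::real_inner \<Rightarrow> 'a set) \<Rightarrow> bool"
  where "strongly_monotone m M \<longleftrightarrow>
    (\<forall>x y. \<forall>u\<in>M x. \<forall>v\<in>M y. m * (norm (x - y))\<^sup>2 \<le> (u - v) \<bullet> (x - y))"

lemma strongly_monotoneD:
  "strongly_monotone m M \<Longrightarrow> u \<in> M x \<Longrightarrow> v \<in> M y \<Longrightarrow> m * (norm (x - y))\<^sup>2 \<le> (u - v) \<bullet> (x - y)"
  unfolding strongly_monotone_def by blast

lemma strongly_monotone_nonneg:
  assumes "strongly_monotone m M" "m \<ge> 0" "u \<in> M x" "v \<in> M y"
  shows "0 \<le> (u - v) \<bullet> (x - y)"
  using order_trans[OF mult_nonneg_nonneg[OF assms(2) zero_le_power2] strongly_monotoneD[OF assms(1,3,4)]] .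

lemma resolvent_eqI:
  assumes M: "strongly_monotone m M" "m \<ge> 0" and \<rho>: "\<rho> > 0"
    and u: "(1 / \<rho>) *\<^sub>R (w - u) \<in> M u"
  shows "resolvent \<rho> M w = u"
  unfolding resolvent_def
proof (rule the_equality)
  have w: "w = u + \<rho> *\<^sub>R ((1 / \<rho>) *\<^sub>R (w - u))" using \<rho> by simp
  show "w \<in> {u} + (*\<^sub>R) \<rho> ` M u"
    by (subst w) (rule set_plus_intro[OF singletonI imageI[OF u]])
next
  fix v assume "w \<in> {v} + (*\<^sub>R) \<rho> ` M v"
  then obtain a where a: "a \<in> M v" "w = v + \<rho> *\<^sub>R a" by (auto elim!: set_plus_elim)
  have "0 \<le> ((1 / \<rho>) *\<^sub>R (w - u) - a) \<bullet> (u - v)"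
    using strongly_monotone_nonneg[OF M u a(1)] .
  moreover have "(1 / \<rho>) *\<^sub>R (w - u) - a = (- 1 / \<rho>) *\<^sub>R (u - v)"
    using \<rho> a(2) by (simp add: algebra_simps)
  ultimately have "0 \<le> (- 1 / \<rho>) * (norm (u - v))\<^sup>2" by (simp add: power2_norm_eq_inner)
  then have "(norm (u - v))\<^sup>2 \<le> 0" using \<rho> by (simp add: field_simps)
  then show "v = u" by simp
qed

lemma reflected_resolvent_nonexpansive:
  assumes M: "strongly_monotone m M" "m \<ge> 0" and \<rho>: "\<rho> > 0"
    and total: "\<And>w. \<exists>u. (1 / \<rho>) *\<^sub>R (w - u) \<in> M u"
  shows "norm (reflected_resolvent \<rho> M w - reflected_resolvent \<rho> M w') \<le> norm (w - w')"
proof -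
  obtain u u' where u: "(1 / \<rho>) *\<^sub>R (w - u) \<in> M u" "(1 / \<rho>) *\<^sub>R (w' - u') \<in> M u'"
    using total[of w] total[of w'] by blast
  have R: "reflected_resolvent \<rho> M w = 2 *\<^sub>R u - w" "reflected_resolvent \<rho> M w' = 2 *\<^sub>R u' - w'"
    unfolding reflected_resolvent_def using resolvent_eqI[OF M \<rho>] u by auto
  have "(1 / \<rho>) *\<^sub>R (w - u) - (1 / \<rho>) *\<^sub>R (w' - u') = (1 / \<rho>) *\<^sub>R ((w - w') - (u - u'))"
    by (simp add: algebra_simps)
  then have "0 \<le> (1 / \<rho>) * (((w - w') - (u - u')) \<bullet> (u - u'))"
    using strongly_monotone_nonneg[OF M u] by simp
  then have nonneg: "0 \<le> ((w - w') - (u - u')) \<bullet> (u - u')"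
    using \<rho> by (simp add: zero_le_divide_iff)
  have "2 *\<^sub>R u - w - (2 *\<^sub>R u' - w') = 2 *\<^sub>R (u - u') - (w - w')" by (simp add: algebra_simps)
  then have "(norm (2 *\<^sub>R u - w - (2 *\<^sub>R u' - w')))\<^sup>2
      = (norm (w - w'))\<^sup>2 - 4 * (((w - w') - (u - u')) \<bullet> (u - u'))"
    unfolding power2_norm_eq_inner
    by (simp only:) (simp add: inner_diff_left inner_diff_right inner_commute algebra_simps)
  then have "(norm (2 *\<^sub>R u - w - (2 *\<^sub>R u' - w')))\<^sup>2 \<le> (norm (w - w'))\<^sup>2" using nonneg by simp
  then show ?thesis unfolding R by (rule power2_le_imp_le) simp
qed

text \<open>
  Fixed points of the Douglas--Rachford operator correspond to zeros of the sum: at a fixed point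
  both resolvents take the same value \<open>x\<close>, and the two residuals are opposite elements of
  \<open>A x\<close> and \<open>B x\<close>.
\<close>

lemma reflected_resolvents_fixpoint_iff:
  assumes A: "strongly_monotone m A" "\<And>w. \<exists>u. (1 / \<rho>) *\<^sub>R (w - u) \<in> A u"
    and B: "strongly_monotone m B" "\<And>w. \<exists>u. (1 / \<rho>) *\<^sub>R (w - u) \<in> B u"
    and m: "m \<ge> 0" and \<rho>: "\<rho> > 0"
  shows "(\<exists>p. reflected_resolvent \<rho> B (reflected_resolvent \<rho> A p) = p)
    \<longleftrightarrow> (\<exists>x y. y \<in> A x \<and> - y \<in> B x)"
proof
  assume "\<exists>p. reflected_resolvent \<rho> B (reflected_resolvent \<rho> A p) = p"
  then obtain p where p: "reflected_resolvent \<rho> B (reflected_resolvent \<rho> A p) = p" ..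
  obtain x where x: "(1 / \<rho>) *\<^sub>R (p - x) \<in> A x" using A(2) by blast
  have RA: "reflected_resolvent \<rho> A p = 2 *\<^sub>R x - p"
    unfolding reflected_resolvent_def using resolvent_eqI[OF A(1) m \<rho> x] by simp
  obtain v where v: "(1 / \<rho>) *\<^sub>R ((2 *\<^sub>R x - p) - v) \<in> B v" using B(2) by blast
  have "2 *\<^sub>R v - (2 *\<^sub>R x - p) = p"
    using p resolvent_eqI[OF B(1) m \<rho> v] unfolding RA by (simp add: reflected_resolvent_def)
  then have "v = x" by simp
  have "(2 *\<^sub>R x - p) - x = - (p - x)" by (simp add: algebra_simps scaleR_2)
  then have "- ((1 / \<rho>) *\<^sub>R (p - x)) \<in> B x"
    using v unfolding \<open>v = x\<close> by (simp only: scaleR_minus_right)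
  then show "\<exists>x y. y \<in> A x \<and> - y \<in> B x" using x by blast
next
  assume "\<exists>x y. y \<in> A x \<and> - y \<in> B x"
  then obtain x y where y: "y \<in> A x" "- y \<in> B x" by blast
  have "resolvent \<rho> A (x + \<rho> *\<^sub>R y) = x" "resolvent \<rho> B (x - \<rho> *\<^sub>R y) = x"
    using y \<rho> by (auto intro!: resolvent_eqI[OF A(1) m \<rho>] resolvent_eqI[OF B(1) m \<rho>])
  \<comment> \<open>The fixed point is the point whose resolvent under \<open>A\<close> is \<open>x\<close> with residual \<open>y\<close>.\<close>
  then have "reflected_resolvent \<rho> B (reflected_resolvent \<rho> A (x + \<rho> *\<^sub>R y)) = x + \<rho> *\<^sub>R y"
    by (simp add: reflected_resolvent_def scaleR_2 algebra_simps)
  then show "\<exists>p. reflected_resolvent \<rho> B (reflected_resolvent \<rho> A p) = p" by blast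
qed

lemma zero_of_sum_iff_bounded_orbit:
  fixes A B :: "'a::{real_inner, complete_space} \<Rightarrow> 'a set"
  assumes A: "strongly_monotone m A" "\<And>w. \<exists>u. (1 / \<rho>) *\<^sub>R (w - u) \<in> A u"
    and B: "strongly_monotone m B" "\<And>w. \<exists>u. (1 / \<rho>) *\<^sub>R (w - u) \<in> B u"
    and m: "m \<ge> 0" and \<rho>: "\<rho> > 0"
    and T: "T = reflected_resolvent \<rho> B \<circ> reflected_resolvent \<rho> A"
  shows "(\<exists>x y. y \<in> A x \<and> - y \<in> B x) \<longleftrightarrow> (\<exists>x. bounded (range (\<lambda>k. (T ^^ k) x)))"
proof -
  have "(\<exists>p. T p = p) \<longleftrightarrow> (\<exists>x. bounded (range (\<lambda>k. (T ^^ k) x)))"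
  proof
    assume "\<exists>p. T p = p"
    then obtain p where "T p = p" ..
    then have "(T ^^ k) p = p" for k by (induction k) auto
    then show "\<exists>x. bounded (range (\<lambda>k. (T ^^ k) x))" by (intro exI[of _ p]) simp
  next
    assume "\<exists>x. bounded (range (\<lambda>k. (T ^^ k) x))"
    then obtain x where x: "bounded (range (\<lambda>k. (T ^^ k) x))" ..
    have "norm (T v - T w) \<le> norm (v - w)" for v w
      unfolding T comp_def
      by (rule order_trans[OF reflected_resolvent_nonexpansive[OF B(1) m \<rho> B(2)]
            reflected_resolvent_nonexpansive[OF A(1) m \<rho> A(2)]])
    from nonexpansive_bounded_orbit_fixpoint[OF this x] show "\<exists>p. T p = p" by blast
  qed
  then show ?thesis using reflected_resolvents_fixpoint_iff[OF A B m \<rho>] by (simp add: T)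
qed

section \<open>Accelerated Douglas--Rachford splitting\<close>

lemma douglas_rachford_step:
  fixes A B :: "'a::real_inner \<Rightarrow> 'a set"
  assumes A: "strongly_monotone \<gamma> A" and B: "strongly_monotone \<gamma> B" and \<gamma>: "\<gamma> \<ge> 0" and r: "r > 0"
    and sol: "y\<^sub>s \<in> A x\<^sub>s" "- y\<^sub>s \<in> B x\<^sub>s"
    and z: "(1 / r) *\<^sub>R (x - r *\<^sub>R y - z) \<in> B z"
    and y': "y' = (1 / r) *\<^sub>R (z + r *\<^sub>R y - x')" "y' \<in> A x'"
  shows "(1 + 2 * r * \<gamma>) * (norm (x' - x\<^sub>s))\<^sup>2 + r\<^sup>2 * (norm (y' - y\<^sub>s))\<^sup>2
    \<le> (norm (x - x\<^sub>s))\<^sup>2 + r\<^sup>2 * (norm (y - y\<^sub>s))\<^sup>2"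
proof -
  define a where "a = x' - x\<^sub>s"
  define b where "b = y' - y\<^sub>s"
  define c where "c = z - x\<^sub>s"
  define d where "d = y - y\<^sub>s"
  define w where "w = (1 / r) *\<^sub>R (x - r *\<^sub>R y - z) + y\<^sub>s"
  have x: "x - x\<^sub>s = c + r *\<^sub>R (d + w)"
    using r by (simp add: c_def d_def w_def algebra_simps)
  have ab: "a + r *\<^sub>R b = c + r *\<^sub>R d"
    using r by (simp add: a_def b_def c_def d_def y'(1) algebra_simps)
  have "\<gamma> * (norm a)\<^sup>2 \<le> b \<bullet> a"
    using strongly_monotoneD[OF A y'(2) sol(1)] by (simp add: a_def b_def)
  then have mono_a: "2 * r * (\<gamma> * (norm a)\<^sup>2) \<le> 2 * r * (b \<bullet> a)"
    using r by (intro mult_left_mono) auto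
  have "0 \<le> w \<bullet> c"
    using strongly_monotone_nonneg[OF B \<gamma> z sol(2)] by (simp add: w_def c_def)
  then have mono_w: "0 \<le> 2 * r * (w \<bullet> c)" using r by simp
  have "(norm a)\<^sup>2 + 2 * r * (b \<bullet> a) + r\<^sup>2 * (norm b)\<^sup>2 = (norm (a + r *\<^sub>R b))\<^sup>2"
    unfolding power2_norm_eq_inner
    by (simp add: inner_add_left inner_add_right inner_commute power2_eq_square)
  \<comment> \<open>Expressing \<open>c + r d\<close> through \<open>x - x\<^sub>s = c + r (d + w)\<close> leaves only the product \<open>w \<bullet> c\<close>,
      whose sign is known from the monotonicity of \<open>B\<close>, and a square.\<close>
  also have "\<dots> = (norm (c + r *\<^sub>R (d + w)))\<^sup>2 + r\<^sup>2 * (norm d)\<^sup>2 - 2 * r * (w \<bullet> c)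
      - r\<^sup>2 * (norm (d + w))\<^sup>2"
    unfolding ab power2_norm_eq_inner
    by (simp add: inner_add_left inner_add_right inner_commute power2_eq_square algebra_simps)
  also have "\<dots> \<le> (norm (x - x\<^sub>s))\<^sup>2 + r\<^sup>2 * (norm d)\<^sup>2"
  proof -
    have "0 \<le> r\<^sup>2 * (norm (d + w))\<^sup>2" by simp
    then show ?thesis unfolding x using mono_w by linarith
  qed
  finally show ?thesis
    using mono_a unfolding a_def[symmetric] b_def[symmetric] d_def[symmetric]
    by (simp add: algebra_simps)
qed

text \<open>
  Dividing the one-step estimate by \<open>r_k\<^sup>2\<close> shows that the potential
  \<open>\<parallel>x_k - x\<^sub>s\<parallel>\<^sup>2 / r_k\<^sup>2 + \<parallel>y_k - y\<^sub>s\<parallel>\<^sup>2\<close> is nonincreasing. The hypotheses start at index \<open>1\<close> because the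
  initial point \<open>z_0\<close> may be arbitrary, instead of being produced by a resolvent of \<open>B\<close>.
\<close>

lemma accelerated_douglas_rachford_bound:
  fixes A B :: "'a::real_inner \<Rightarrow> 'a set"
  assumes A: "strongly_monotone \<gamma> A" and B: "strongly_monotone \<gamma> B" and \<gamma>: "\<gamma> \<ge> 0"
    and r: "\<And>k. r k > 0" "\<And>k. r (Suc k) = r k / sqrt (1 + 2 * r k * \<gamma>)"
    and sol: "y\<^sub>s \<in> A x\<^sub>s" "- y\<^sub>s \<in> B x\<^sub>s"
    and z: "\<And>k. k \<ge> 1 \<Longrightarrow> (1 / r k) *\<^sub>R (x k - r k *\<^sub>R y k - z k) \<in> B (z k)"
    and y: "\<And>k. k \<ge> 1 \<Longrightarrow> y (Suc k) = (1 / r k) *\<^sub>R (z k + r k *\<^sub>R y k - x (Suc k))"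
           "\<And>k. k \<ge> 1 \<Longrightarrow> y (Suc k) \<in> A (x (Suc k))"
  obtains C where "C \<ge> 0" "\<And>k. k \<ge> 1 \<Longrightarrow> norm (x k - x\<^sub>s) \<le> C * r k"
proof -
  define V where "V k = (norm (x k - x\<^sub>s))\<^sup>2 / (r k)\<^sup>2 + (norm (y k - y\<^sub>s))\<^sup>2" for k
  have step: "V (Suc k) \<le> V k" if k: "k \<ge> 1" for k
  proof -
    have "0 \<le> 2 * r k * \<gamma>" using r(1)[of k] \<gamma> by simp
    then have "(r (Suc k))\<^sup>2 = (r k)\<^sup>2 / (1 + 2 * r k * \<gamma>)"
      unfolding r(2) power_divide by simp
    then have "V (Suc k) = ((1 + 2 * r k * \<gamma>) * (norm (x (Suc k) - x\<^sub>s))\<^sup>2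
        + (r k)\<^sup>2 * (norm (y (Suc k) - y\<^sub>s))\<^sup>2) / (r k)\<^sup>2"
      using r(1)[of k] by (simp add: V_def add_divide_distrib mult.commute)
    also have "\<dots> \<le> ((norm (x k - x\<^sub>s))\<^sup>2 + (r k)\<^sup>2 * (norm (y k - y\<^sub>s))\<^sup>2) / (r k)\<^sup>2"
      using douglas_rachford_step[OF A B \<gamma> r(1) sol z[OF k] y(1)[OF k] y(2)[OF k]]
      by (intro divide_right_mono) auto
    also have "\<dots> = V k" using r(1)[of k] by (simp add: V_def add_divide_distrib)
    finally show ?thesis .
  qed
  have "norm (x k - x\<^sub>s) \<le> sqrt (V 1) * r k" if "k \<ge> 1" for k
  proof -
    have "V k \<le> V 1" using that by (induction k rule: dec_induct) (use step order_trans in auto)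
    then have "(norm (x k - x\<^sub>s))\<^sup>2 / (r k)\<^sup>2 \<le> V 1"
      using zero_le_power2[of "norm (y k - y\<^sub>s)"] unfolding V_def[of k] by linarith
    then have "(norm (x k - x\<^sub>s) / r k)\<^sup>2 \<le> V 1" by (simp add: power_divide)
    then have "norm (x k - x\<^sub>s) / r k \<le> sqrt (V 1)" by (rule real_le_rsqrt)
    then show ?thesis using r(1)[of k] by (simp add: field_simps)
  qed
  moreover have "V 1 \<ge> 0" by (simp add: V_def)
  ultimately show ?thesis using that[of "sqrt (V 1)"] by simp
qed

text \<open>
  The inverses \<open>s_k = 1 / r_k\<close> satisfy \<open>s_{k+1}\<^sup>2 = s_k\<^sup>2 + 2 \<gamma> s_k\<close>. As they stay above \<open>1 / R\<close>, the
  right-hand side dominates \<open>(s_k + c)\<^sup>2\<close> as soon as \<open>c \<le> \<gamma> / 2\<close> and \<open>c\<^sup>2 \<le> \<gamma> / R\<close>.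
\<close>

lemma accelerated_step_size_bound:
  fixes r :: "nat \<Rightarrow> real"
  assumes \<gamma>: "\<gamma> > 0" and r: "\<And>k. r k > 0" "\<And>k. r k \<le> R"
    "\<And>k. r (Suc k) = r k / sqrt (1 + 2 * r k * \<gamma>)"
  obtains c where "c > 0" "\<And>k. c * real k * r k \<le> 1"
proof -
  have R: "R > 0" using r(1,2)[of 0] by linarith
  define c where "c = min (\<gamma> / 2) (sqrt (\<gamma> / R))"
  have c: "c > 0" "c \<le> \<gamma> / 2" using \<gamma> R by (auto simp: c_def)
  have "c\<^sup>2 \<le> (sqrt (\<gamma> / R))\<^sup>2" using c(1) by (intro power_mono) (auto simp: c_def)
  then have c2: "c\<^sup>2 \<le> \<gamma> / R" using \<gamma> R by simp
  have "c * real k \<le> 1 / r k" for k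
  proof (induction k)
    case 0
    then show ?case using r(1)[of 0] by simp
  next
    case (Suc k)
    define s where "s = 1 / r k"
    have s: "s > 0" "1 / R \<le> s" using r(1,2)[of k] by (auto simp: s_def frac_le)
    have "\<gamma> / R \<le> \<gamma> * s" using mult_left_mono[OF s(2), of \<gamma>] \<gamma> by simp
    moreover have "2 * c * s \<le> \<gamma> * s" using c(2) s(1) by (simp add: mult_right_mono)
    ultimately have "c\<^sup>2 + 2 * c * s \<le> 2 * (\<gamma> * s)" using c2 by linarith
    then have "(s + c)\<^sup>2 \<le> s\<^sup>2 + 2 * \<gamma> * s" by (simp add: power2_sum algebra_simps)
    also have "\<dots> = s\<^sup>2 * (1 + 2 * r k * \<gamma>)"
      using r(1)[of k] by (simp add: s_def power2_eq_square field_simps)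
    finally have "s + c \<le> sqrt (s\<^sup>2 * (1 + 2 * r k * \<gamma>))" by (rule real_le_rsqrt)
    also have "\<dots> = 1 / r (Suc k)" using s(1) by (simp add: r(3) s_def real_sqrt_mult real_sqrt_divide)
    finally show ?case using Suc by (simp add: s_def algebra_simps)
  qed
  then have "c * real k * r k \<le> 1" for k by (simp only: r(1) pos_le_divide_eq)
  then show ?thesis using that c(1) by blast
qed

section \<open>Strengthenings of subdifferentials\<close>

lemma subdifferential_monotone:
  fixes h :: "'a::real_inner \<Rightarrow> ereal"
  assumes "proper_fun h" "u \<in> subdifferential h x" "v \<in> subdifferential h y"
  shows "0 \<le> (u - v) \<bullet> (x - y)"
proof -
  obtain a where a: "h x = ereal a" by (rule subdifferential_finite[OF assms(1,2)])
  obtain b where b: "h y = ereal b" by (rule subdifferential_finite[OF assms(1,3)])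
  have "h x + ereal (u \<bullet> (y - x)) \<le> h y" "h y + ereal (v \<bullet> (x - y)) \<le> h x"
    using assms(2,3) unfolding subdifferential_def by auto
  then have "a + u \<bullet> (y - x) \<le> b" "b + v \<bullet> (x - y) \<le> a" by (auto simp: a b)
  then show ?thesis by (simp add: inner_diff_left inner_diff_right)
qed

lemma mem_strengthening:
  "v \<in> strengthening M z \<beta> x \<longleftrightarrow>
    (\<exists>a\<in>M ((1 / \<beta>) *\<^sub>R x + z). v = (2 * (1 - \<beta>)) *\<^sub>R a + ((1 - \<beta>) / \<beta>) *\<^sub>R x)"
  unfolding strengthening_def by (auto elim!: set_plus_elim intro!: set_plus_intro)

lemma strengthening_subdifferential_strongly_monotone:
  fixes h :: "'a::real_inner \<Rightarrow> ereal"
  assumes h: "proper_fun h" and \<beta>: "0 < \<beta>" "\<beta> < 1"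
  shows "strongly_monotone ((1 - \<beta>) / \<beta>) (strengthening (subdifferential h) z \<beta>)"
  unfolding strongly_monotone_def
proof (intro allI ballI)
  fix x y u v
  assume "u \<in> strengthening (subdifferential h) z \<beta> x" "v \<in> strengthening (subdifferential h) z \<beta> y"
  then obtain a b where a: "a \<in> subdifferential h ((1 / \<beta>) *\<^sub>R x + z)"
      "u = (2 * (1 - \<beta>)) *\<^sub>R a + ((1 - \<beta>) / \<beta>) *\<^sub>R x"
    and b: "b \<in> subdifferential h ((1 / \<beta>) *\<^sub>R y + z)"
      "v = (2 * (1 - \<beta>)) *\<^sub>R b + ((1 - \<beta>) / \<beta>) *\<^sub>R y"
    unfolding mem_strengthening by blast
  have "((1 / \<beta>) *\<^sub>R x + z) - ((1 / \<beta>) *\<^sub>R y + z) = (1 / \<beta>) *\<^sub>R (x - y)" by (simp add: algebra_simps)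
  then have "0 \<le> (1 / \<beta>) * ((a - b) \<bullet> (x - y))"
    using subdifferential_monotone[OF h a(1) b(1)] by simp
  then have nonneg: "0 \<le> (a - b) \<bullet> (x - y)" using \<beta> by (simp add: zero_le_divide_iff)
  have "u - v = (2 * (1 - \<beta>)) *\<^sub>R (a - b) + ((1 - \<beta>) / \<beta>) *\<^sub>R (x - y)"
    unfolding a(2) b(2) by (simp add: algebra_simps)
  then have "(u - v) \<bullet> (x - y) = 2 * (1 - \<beta>) * ((a - b) \<bullet> (x - y)) + (1 - \<beta>) / \<beta> * (norm (x - y))\<^sup>2"
    by (simp add: inner_add_left power2_norm_eq_inner)
  then show "(1 - \<beta>) / \<beta> * (norm (x - y))\<^sup>2 \<le> (u - v) \<bullet> (x - y)"
    using nonneg \<beta> by simp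
qed

text \<open>
  The rescaled proximal point is the value at \<open>w\<close> of the resolvent of the strengthening: with
  \<open>u = x / \<beta> + z\<close>, the inclusion \<open>w \<in> x + r (2 (1 - \<beta>) \<partial>h(u) + (1 - \<beta>) / \<beta> x)\<close> becomes, after
  division by \<open>\<beta> + r (1 - \<beta>)\<close>, the optimality condition of the proximal point \<open>u\<close>.
\<close>

lemma prox_residual_in_strengthening:
  fixes h :: "'a::{real_inner, complete_space} \<Rightarrow> ereal"
  assumes h: "proper_fun h" "lsc_fun h" "convex_fun h" and \<beta>: "0 < \<beta>" "\<beta> < 1" and r: "r > 0"
    and x: "x = \<beta> *\<^sub>R prox (2 * r * (1 - \<beta>) / (\<beta> + r * (1 - \<beta>))) h
      ((1 / (\<beta> + r * (1 - \<beta>))) *\<^sub>R w + z) - \<beta> *\<^sub>R z"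
  shows "(1 / r) *\<^sub>R (w - x) \<in> strengthening (subdifferential h) z \<beta> x"
proof -
  define D where "D = \<beta> + r * (1 - \<beta>)"
  define \<rho> where "\<rho> = 2 * r * (1 - \<beta>) / D"
  have D: "D > 0" using \<beta> r by (simp add: D_def add_pos_pos)
  have \<rho>: "\<rho> > 0" using \<beta> r D by (simp add: \<rho>_def)
  define u where "u = prox \<rho> h ((1 / D) *\<^sub>R w + z)"
  define a where "a = (1 / \<rho>) *\<^sub>R ((1 / D) *\<^sub>R w + z - u)"
  have a: "a \<in> subdifferential h u"
    unfolding a_def u_def by (rule prox_residual_in_subdifferential[OF h \<rho>])
  have xu: "x = \<beta> *\<^sub>R (u - z)" using x by (simp add: u_def \<rho>_def D_def algebra_simps)
  have u: "(1 / \<beta>) *\<^sub>R x + z = u" using \<beta> by (simp add: xu)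
  have "2 * (1 - \<beta>) * (1 / \<rho>) = D / r" using \<beta> r D by (simp add: \<rho>_def field_simps)
  then have "(2 * (1 - \<beta>)) *\<^sub>R a = (D / r) *\<^sub>R ((1 / D) *\<^sub>R w - (u - z))"
    unfolding a_def scaleR_scaleR by (simp add: add_diff_eq diff_diff_eq2)
  also have "\<dots> = (1 / r) *\<^sub>R w - (D / r) *\<^sub>R (u - z)"
    using D by (simp add: scaleR_right_diff_distrib)
  finally have "(2 * (1 - \<beta>)) *\<^sub>R a + ((1 - \<beta>) / \<beta>) *\<^sub>R x
      = (1 / r) *\<^sub>R w + ((1 - \<beta>) - D / r) *\<^sub>R (u - z)"
    using \<beta> by (simp add: xu scaleR_left_diff_distrib)
  also have "(1 - \<beta>) - D / r = - (1 / r) * \<beta>" using r by (simp add: D_def field_simps)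
  also have "(1 / r) *\<^sub>R w + (- (1 / r) * \<beta>) *\<^sub>R (u - z) = (1 / r) *\<^sub>R (w - x)"
    by (simp add: xu scaleR_right_diff_distrib)
  finally have "(1 / r) *\<^sub>R (w - x) = (2 * (1 - \<beta>)) *\<^sub>R a + ((1 - \<beta>) / \<beta>) *\<^sub>R x" by (rule sym)
  then show ?thesis unfolding mem_strengthening u using a by (rule bexI)
qed

lemma strengthening_zero_iff:
  fixes A B :: "'a::real_vector \<Rightarrow> 'a set"
  assumes \<beta>: "0 < \<beta>" "\<beta> < 1"
  shows "(\<exists>y. y \<in> strengthening A z \<beta> x \<and> - y \<in> strengthening B z \<beta> x)
    \<longleftrightarrow> z \<in> {(1 / \<beta>) *\<^sub>R x + z} + (A ((1 / \<beta>) *\<^sub>R x + z) + B ((1 / \<beta>) *\<^sub>R x + z))"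
proof -
  let ?u = "(1 / \<beta>) *\<^sub>R x + z"
  have *: "- ((2 * (1 - \<beta>)) *\<^sub>R a + ((1 - \<beta>) / \<beta>) *\<^sub>R x) = (2 * (1 - \<beta>)) *\<^sub>R b + ((1 - \<beta>) / \<beta>) *\<^sub>R x
      \<longleftrightarrow> z = ?u + (a + b)" (is "?L \<longleftrightarrow> ?R") for a b
  proof -
    have "?L \<longleftrightarrow> (2 * (1 - \<beta>)) *\<^sub>R (a + b) + (2 * ((1 - \<beta>) / \<beta>)) *\<^sub>R x = 0"
    proof -
      have "(2 * (1 - \<beta>)) *\<^sub>R (a + b) + (2 * ((1 - \<beta>) / \<beta>)) *\<^sub>R x
          = ((2 * (1 - \<beta>)) *\<^sub>R a + ((1 - \<beta>) / \<beta>) *\<^sub>R x) + ((2 * (1 - \<beta>)) *\<^sub>R b + ((1 - \<beta>) / \<beta>) *\<^sub>R x)"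
        by (simp only: mult_2 scaleR_left_distrib scaleR_right_distrib ac_simps)
      then show ?thesis by (simp only: neg_eq_iff_add_eq_0)
    qed
    also have "(2 * (1 - \<beta>)) *\<^sub>R (a + b) + (2 * ((1 - \<beta>) / \<beta>)) *\<^sub>R x
        = (2 * (1 - \<beta>)) *\<^sub>R ((1 / \<beta>) *\<^sub>R x + (a + b))"
      by (simp add: scaleR_right_distrib)
    also have "\<dots> = 0 \<longleftrightarrow> (1 / \<beta>) *\<^sub>R x + (a + b) = 0" using \<beta> by simp
    also have "\<dots> \<longleftrightarrow> ?R"
    proof -
      have "?u + (a + b) = z + ((1 / \<beta>) *\<^sub>R x + (a + b))" by (simp only: ac_simps)
      then show ?thesis by (simp only: add_cancel_right_right)
    qed
    finally show ?thesis .
  qed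
  have elim_y: "(\<exists>y. (\<exists>a\<in>P. y = F a) \<and> (\<exists>b\<in>Q. - y = G b)) \<longleftrightarrow> (\<exists>a\<in>P. \<exists>b\<in>Q. - F a = G b)"
    for P Q and F G :: "'a \<Rightarrow> 'a" by blast
  have "(\<exists>y. y \<in> strengthening A z \<beta> x \<and> - y \<in> strengthening B z \<beta> x)
      \<longleftrightarrow> (\<exists>a\<in>A ?u. \<exists>b\<in>B ?u. z = ?u + (a + b))"
    unfolding mem_strengthening elim_y * by (rule refl)
  also have "\<dots> \<longleftrightarrow> z \<in> {?u} + (A ?u + B ?u)"
    unfolding set_plus_def by blast
  finally show ?thesis .
qed

lemma resolvent_exists_iff_strengthening_zero:
  assumes \<beta>: "0 < \<beta>" "\<beta> < 1"
  shows "resolvent_exists (\<lambda>u. A u + B u) z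
    \<longleftrightarrow> (\<exists>x y. y \<in> strengthening A z \<beta> x \<and> - y \<in> strengthening B z \<beta> x)"
proof -
  have "resolvent_exists (\<lambda>u. A u + B u) z \<longleftrightarrow>
      (\<exists>x. z \<in> {(1 / \<beta>) *\<^sub>R x + z} + (A ((1 / \<beta>) *\<^sub>R x + z) + B ((1 / \<beta>) *\<^sub>R x + z)))"
  proof
    assume "resolvent_exists (\<lambda>u. A u + B u) z"
    then obtain u where "z \<in> {u} + (A u + B u)" unfolding resolvent_exists_def ..
    moreover have "(1 / \<beta>) *\<^sub>R (\<beta> *\<^sub>R (u - z)) + z = u" using \<beta> by simp
    ultimately show "\<exists>x. z \<in> {(1 / \<beta>) *\<^sub>R x + z} + (A ((1 / \<beta>) *\<^sub>R x + z) + B ((1 / \<beta>) *\<^sub>R x + z))"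
      by (intro exI[of _ "\<beta> *\<^sub>R (u - z)"]) (simp only:)
  qed (auto simp: resolvent_exists_def)
  then show ?thesis unfolding strengthening_zero_iff[OF \<beta>, symmetric] by simp
qed

section \<open>Characterization of existence, convergence and rate\<close>

theorem corollary5p1:
  fixes f g :: "'a::{real_inner, complete_space} \<Rightarrow> ereal"
    and z :: 'a
    and \<beta> \<rho> :: real
    and r :: "nat \<Rightarrow> real"
    and xs ys zs :: "nat \<Rightarrow> 'a"
    and T :: "'a \<Rightarrow> 'a"
  assumes f: "proper_fun f" "lsc_fun f" "convex_fun f"
    and g: "proper_fun g" "lsc_fun g" "convex_fun g"
    and dom: "dom_fun f \<inter> dom_fun g \<noteq> {}"
    and beta: "0 < \<beta>" "\<beta> < 1"
    and r_range: "\<And>k. 0 < r k \<and> r k < 2 * (1 - \<beta>) / \<beta>"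
    and r_Suc: "\<And>k. r (k + 1) = r k / sqrt (1 + 2 * r k * (1 - \<beta>) / \<beta>)"
    and x_0: "xs 0 =
      \<beta> *\<^sub>R prox (2 * r 0 * (1 - \<beta>) / (\<beta> + r 0 * (1 - \<beta>))) f
        ((1 / (\<beta> + r 0 * (1 - \<beta>))) *\<^sub>R zs 0 + z) - \<beta> *\<^sub>R z"
    and y_0: "ys 0 = (1 / r 0) *\<^sub>R (zs 0 - xs 0)"
    and x_k: "\<And>k. k \<ge> 1 \<Longrightarrow> xs k =
      \<beta> *\<^sub>R prox (2 * r (k - 1) * (1 - \<beta>) / (\<beta> + r (k - 1) * (1 - \<beta>))) f
        ((1 / (\<beta> + r (k - 1) * (1 - \<beta>))) *\<^sub>R (zs (k - 1) + r (k - 1) *\<^sub>R ys (k - 1)) + z)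
        - \<beta> *\<^sub>R z"
    and y_k: "\<And>k. k \<ge> 1 \<Longrightarrow> ys k =
      (1 / r (k - 1)) *\<^sub>R (zs (k - 1) + r (k - 1) *\<^sub>R ys (k - 1) - xs k)"
    and z_k: "\<And>k. k \<ge> 1 \<Longrightarrow> zs k =
      \<beta> *\<^sub>R prox (2 * r k * (1 - \<beta>) / (\<beta> + r k * (1 - \<beta>))) g
        ((1 / (\<beta> + r k * (1 - \<beta>))) *\<^sub>R (xs k - r k *\<^sub>R ys k) + z) - \<beta> *\<^sub>R z"
    and rho: "\<rho> > 0"
    and T: "T = reflected_resolvent \<rho> (strengthening (subdifferential g) z \<beta>)
              \<circ> reflected_resolvent \<rho> (strengthening (subdifferential f) z \<beta>)"
  shows "(resolvent_exists (\<lambda>u. subdifferential f u + subdifferential g u) z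
            \<longleftrightarrow> (\<exists>x. bounded (range (\<lambda>k. (T ^^ k) x))))
    \<and> (resolvent_exists (\<lambda>u. subdifferential f u + subdifferential g u) z
        \<longrightarrow> (\<lambda>k. (1 / \<beta>) *\<^sub>R xs k + z) \<longlonglongrightarrow> prox 1 (\<lambda>x. f x + g x) z
          \<and> (\<lambda>k. norm ((1 / \<beta>) *\<^sub>R xs (k + 1) + z - prox 1 (\<lambda>x. f x + g x) z))
              \<in> O(\<lambda>k. 1 / real k))"
proof -
  define \<gamma> where "\<gamma> = (1 - \<beta>) / \<beta>"
  define A where "A = strengthening (subdifferential f) z \<beta>"
  define B where "B = strengthening (subdifferential g) z \<beta>"
  have \<gamma>: "\<gamma> > 0" using beta by (simp add: \<gamma>_def)
  have A: "strongly_monotone \<gamma> A" and B: "strongly_monotone \<gamma> B"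
    unfolding A_def B_def \<gamma>_def
    using strengthening_subdifferential_strongly_monotone f g beta by blast+
  have totalA: "\<exists>u. (1 / \<rho>) *\<^sub>R (w - u) \<in> A u" and totalB: "\<exists>u. (1 / \<rho>) *\<^sub>R (w - u) \<in> B u" for w
    unfolding A_def B_def
    using prox_residual_in_strengthening[OF f beta rho refl]
      prox_residual_in_strengthening[OF g beta rho refl] by blast+
  let ?ex = "resolvent_exists (\<lambda>u. subdifferential f u + subdifferential g u) z"
  let ?p = "prox 1 (\<lambda>x. f x + g x) z"
  have zero: "?ex \<longleftrightarrow> (\<exists>x y. y \<in> A x \<and> - y \<in> B x)"
    unfolding A_def B_def by (rule resolvent_exists_iff_strengthening_zero[OF beta])
  have i: "?ex \<longleftrightarrow> (\<exists>x. bounded (range (\<lambda>k. (T ^^ k) x)))"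
    unfolding zero using zero_of_sum_iff_bounded_orbit[OF A totalA B totalB _ rho T[folded A_def B_def]] \<gamma>
    by simp
  have ii: "(\<lambda>k. (1 / \<beta>) *\<^sub>R xs k + z) \<longlonglongrightarrow> ?p
      \<and> (\<lambda>k. norm ((1 / \<beta>) *\<^sub>R xs (k + 1) + z - ?p)) \<in> O(\<lambda>k. 1 / real k)" if ?ex
  proof -
    obtain x\<^sub>s y\<^sub>s where sol: "y\<^sub>s \<in> A x\<^sub>s" "- y\<^sub>s \<in> B x\<^sub>s" using \<open>?ex\<close> zero by blast
    then have "z \<in> {(1 / \<beta>) *\<^sub>R x\<^sub>s + z} + (subdifferential f ((1 / \<beta>) *\<^sub>R x\<^sub>s + z)
        + subdifferential g ((1 / \<beta>) *\<^sub>R x\<^sub>s + z))"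
      unfolding A_def B_def using strengthening_zero_iff[OF beta] by blast
    then have p: "?p = (1 / \<beta>) *\<^sub>R x\<^sub>s + z"
      using resolvent_sum_eq_prox[OF f(1) g(1)] by (auto elim!: set_plus_elim)
    have r: "r k > 0" "r k \<le> 2 * \<gamma>" "r (Suc k) = r k / sqrt (1 + 2 * r k * \<gamma>)" for k
      using r_range[of k] r_Suc[of k] by (auto simp: \<gamma>_def)
    have zB: "(1 / r k) *\<^sub>R (xs k - r k *\<^sub>R ys k - zs k) \<in> B (zs k)" if "k \<ge> 1" for k
      unfolding B_def by (rule prox_residual_in_strengthening[OF g beta r(1) z_k[OF that]])
    have y: "ys (Suc k) = (1 / r k) *\<^sub>R (zs k + r k *\<^sub>R ys k - xs (Suc k))" for k
      using y_k[of "Suc k"] by simp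
    have yA: "ys (Suc k) \<in> A (xs (Suc k))" for k
      unfolding A_def y
      by (rule prox_residual_in_strengthening[OF f beta r(1)]) (use x_k[of "Suc k"] in simp)
    obtain C where C: "C \<ge> 0" "\<And>k. k \<ge> 1 \<Longrightarrow> norm (xs k - x\<^sub>s) \<le> C * r k"
      using accelerated_douglas_rachford_bound[where r = r and x = xs and y = ys and z = zs,
          OF A B less_imp_le[OF \<gamma>] r(1) r(3) sol zB y yA] by blast
    obtain c where c: "c > 0" "\<And>k. c * real k * r k \<le> 1"
      using accelerated_step_size_bound[where r = r, OF \<gamma> r] by blast
    define K where "K = C / (c * \<beta>)"
    have bound: "norm ((1 / \<beta>) *\<^sub>R xs k + z - ?p) \<le> K * (1 / real k)" if k: "k \<ge> 1" for k
    proof -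
      have "(1 / \<beta>) *\<^sub>R xs k + z - ?p = (1 / \<beta>) *\<^sub>R (xs k - x\<^sub>s)"
        unfolding p by (simp add: algebra_simps)
      then have "norm ((1 / \<beta>) *\<^sub>R xs k + z - ?p) = norm (xs k - x\<^sub>s) / \<beta>" using beta by simp
      also have "\<dots> \<le> C * r k / \<beta>" using C(2)[OF k] beta by (simp add: divide_right_mono)
      also have "\<dots> \<le> C * (1 / (c * real k)) / \<beta>"
      proof -
        have "r k \<le> 1 / (c * real k)" using c(1) c(2)[of k] k by (simp add: field_simps)
        then show ?thesis using C(1) beta by (intro divide_right_mono mult_left_mono) auto
      qed
      finally show ?thesis by (simp add: K_def mult.commute mult.left_commute)
    qed
    have K: "K \<ge> 0" using C(1) c(1) beta by (simp add: K_def)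
    have "(\<lambda>k. (1 / \<beta>) *\<^sub>R xs k + z - ?p) \<longlonglongrightarrow> 0"
    proof (rule Lim_null_comparison)
      show "\<forall>\<^sub>F k in sequentially. norm ((1 / \<beta>) *\<^sub>R xs k + z - ?p) \<le> K * (1 / real k)"
        using bound by (auto simp: eventually_sequentially)
      show "(\<lambda>k. K * (1 / real k)) \<longlonglongrightarrow> 0"
        using tendsto_mult_right_zero[OF lim_1_over_n] by simp
    qed
    then have "(\<lambda>k. (1 / \<beta>) *\<^sub>R xs k + z) \<longlonglongrightarrow> ?p" by (simp add: LIM_zero_iff)
    moreover have "(\<lambda>k. norm ((1 / \<beta>) *\<^sub>R xs (k + 1) + z - ?p)) \<in> O(\<lambda>k. 1 / real k)"
    proof (rule bigoI)
      have "norm ((1 / \<beta>) *\<^sub>R xs (k + 1) + z - ?p) \<le> K * (1 / real k)" if "k \<ge> 1" for k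
      proof -
        have "K * (1 / real (k + 1)) \<le> K * (1 / real k)"
          using K that by (intro mult_left_mono frac_le) auto
        then show ?thesis using bound[of "k + 1"] by linarith
      qed
      then show "\<forall>\<^sub>F k in sequentially. norm (norm ((1 / \<beta>) *\<^sub>R xs (k + 1) + z - ?p))
          \<le> K * norm (1 / real k)"
        by (auto simp: eventually_sequentially)
    qed
    ultimately show ?thesis ..
  qed
  show ?thesis using i ii by blast
qed

end
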